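(* Consider the Range Subgraph Counting problem with pattern $Q=$ wedge. Fix any $\lambda\in[1,\sqrt{m}]$ and any constant $\delta>0$. Suppose that we can obtain a structure for this problem of $\tilde{O}(m^{2-\delta}/\lambda^2)$ space answering a query in $\tilde{O}(\lambda)$ time. Then, for any Set Disjointness input of size $N$, we can obtain a structure of $\tilde{O}(N^{2-\delta}/\lambda^2)$ space answering a query in $\tilde{O}(\lambda)$ time.
   Context: Range Subgraph Counting: $G=(V,E)$ is an undirected graph with $m=|E|$ edges, where each vertex $v$ carries a real-valued attribute $A_v$. For an interval $q=[x_1,x_2]$, $G_q$ is the subgraph of $G$ induced by $\{v\in V\mid x_1\le A_v\le x_2\}$. A query, given $q$, returns the number of occurrences (subgraphs isomorphic to the pattern) of the wedge (the path with 2 edges) in $G_q$. Set Disjointness: the data is a collection of $s\ge 2$ sets $S_1,\dots,S_s$ with total size $N=\sum_{i=1}^s|S_i|$; a query, given distinct ids $a,b\in[1,s]$, returns whether $S_a\cap S_b$ is empty. The notation $\tilde{O}(\cdot)$ hides polylogarithmic factors. *)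

theory Defs
  imports Complex_Main "HOL-Library.Landau_Symbols"
begin

section \<open>Asymptotics up to polylogarithmic factors\<close>

definition soft_O :: "(nat \<Rightarrow> real) \<Rightarrow> (nat \<Rightarrow> real) set" where
  "soft_O g = {f. \<exists>k::nat. f \<in> O(\<lambda>n. g n * ln (real n) ^ k)}"


section \<open>The random access machine\<close>

text \<open>
  A register or memory cell holds either a machine word or an attribute value.  Attribute values
  are arbitrary reals, but programs can only copy them, compare them, and create them from
  integers.  There is no real arithmetic, because with it one cell could be used to store and
  decode an unbounded amount of information, which would make counting cells meaningless.
\<close>

datatype cell = Word int | Real real

datatype binop = Add | Sub | Mul | Div | Mod | And | Or | Xor | Shl | Shr

fun alu :: "binop \<Rightarrow> int \<Rightarrow> int \<Rightarrow> int" where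
  "alu Add a b = a + b"
| "alu Sub a b = a - b"
| "alu Mul a b = a * b"
| "alu Div a b = a div b"
| "alu Mod a b = a mod b"
| "alu And a b = and a b"
| "alu Or a b = or a b"
| "alu Xor a b = xor a b"
| "alu Shl a b = push_bit (nat b) a"
| "alu Shr a b = drop_bit (nat b) a"

text \<open>Register names come first; \<open>Load r p\<close> and \<open>Store p r\<close> address memory through register \<open>p\<close>.\<close>

datatype instr =
    Const nat int
  | Copy nat nat
  | Alu binop nat nat nat
  | To_Real nat nat
  | Load nat nat
  | Store nat nat

text \<open>\<open>Branch x y\<close> and \<open>While x y\<close> test whether register \<open>x\<close> is smaller than register \<open>y\<close>.\<close>

datatype com =
    Skip
  | Basic instr
  | Seq com com
  | Branch nat nat com com
  | While nat nat com

type_synonym memory = "nat \<Rightarrow> cell"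
type_synonym state = "(nat \<Rightarrow> cell) \<times> memory"

text \<open>
  The word length enters as a bound \<open>B\<close> on the absolute value of every word.  An operation that
  exceeds it, or that is applied to a cell of the wrong kind, gets stuck.
\<close>

fun fits :: "int \<Rightarrow> cell \<Rightarrow> bool" where
  "fits B (Word a) \<longleftrightarrow> \<bar>a\<bar> \<le> B"
| "fits B (Real x) \<longleftrightarrow> True"

fun less_cell :: "cell \<Rightarrow> cell \<Rightarrow> bool option" where
  "less_cell (Word a) (Word b) = Some (a < b)"
| "less_cell (Real x) (Real y) = Some (x < y)"
| "less_cell _ _ = None"

definition set_reg :: "int \<Rightarrow> nat \<Rightarrow> cell \<Rightarrow> state \<Rightarrow> state option" where
  "set_reg B x v s = (if fits B v then Some ((fst s)(x := v), snd s) else None)"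

fun step :: "int \<Rightarrow> instr \<Rightarrow> state \<Rightarrow> state option" where
  "step B (Const x a) s = set_reg B x (Word a) s"
| "step B (Copy x y) s = set_reg B x (fst s y) s"
| "step B (Alu f x y z) s =
     (case (fst s y, fst s z) of
        (Word a, Word b) \<Rightarrow> set_reg B x (Word (alu f a b)) s
      | _ \<Rightarrow> None)"
| "step B (To_Real x y) s =
     (case fst s y of Word a \<Rightarrow> set_reg B x (Real (of_int a)) s | Real _ \<Rightarrow> None)"
| "step B (Load x p) s =
     (case fst s p of
        Word a \<Rightarrow> if 0 \<le> a then set_reg B x (snd s (nat a)) s else None
      | Real _ \<Rightarrow> None)"
| "step B (Store p y) s =
     (case fst s p of
        Word a \<Rightarrow> if 0 \<le> a then Some (fst s, (snd s)(nat a := fst s y)) else None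
      | Real _ \<Rightarrow> None)"

text \<open>\<open>exec B c s t s'\<close>: from state \<open>s\<close>, program \<open>c\<close> terminates after \<open>t\<close> unit-cost steps in \<open>s'\<close>.\<close>

inductive exec :: "int \<Rightarrow> com \<Rightarrow> state \<Rightarrow> nat \<Rightarrow> state \<Rightarrow> bool" for B :: int where
  Skip: "exec B Skip s 0 s"
| Basic: "step B i s = Some s' \<Longrightarrow> exec B (Basic i) s 1 s'"
| Seq: "exec B c s t s' \<Longrightarrow> exec B d s' t' s'' \<Longrightarrow> exec B (Seq c d) s (t + t') s''"
| BranchTrue: "less_cell (fst s x) (fst s y) = Some True \<Longrightarrow> exec B c s t s' \<Longrightarrow>
    exec B (Branch x y c d) s (t + 1) s'"
| BranchFalse: "less_cell (fst s x) (fst s y) = Some False \<Longrightarrow> exec B d s t s' \<Longrightarrow>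
    exec B (Branch x y c d) s (t + 1) s'"
| WhileFalse: "less_cell (fst s x) (fst s y) = Some False \<Longrightarrow> exec B (While x y c) s 1 s"
| WhileTrue: "less_cell (fst s x) (fst s y) = Some True \<Longrightarrow> exec B c s t s' \<Longrightarrow>
    exec B (While x y c) s' t' s'' \<Longrightarrow> exec B (While x y c) s (t + t' + 1) s''"


section \<open>Data structure problems\<close>

text \<open>
  \<open>data_size\<close> is the parameter in which space and query time are measured.  \<open>word_size\<close> is the
  quantity \<open>n\<close> such that a machine word has \<open>O(log n)\<close> bits.  \<open>queries d\<close> is the set of all
  \<open>(u, v, r)\<close> such that \<open>r\<close> is the correct answer on data \<open>d\<close> to the query with inputs \<open>u, v\<close>.
\<close>

record 'd data_problem =
  valid_data :: "'d \<Rightarrow> bool"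
  data_size :: "'d \<Rightarrow> nat"
  word_size :: "'d \<Rightarrow> nat"
  queries :: "'d \<Rightarrow> (cell \<times> cell \<times> cell) set"

definition query_regs :: "cell \<Rightarrow> cell \<Rightarrow> nat \<Rightarrow> cell" where
  "query_regs u v = (\<lambda>_. Word 0)(0 := u, 1 := v)"

text \<open>
  The memory image \<open>M\<close> occupies the first \<open>S\<close> cells, and program \<open>c\<close> answers each query in at
  most \<open>T\<close> steps, leaving the answer in register 0.  The structure must be able to serve any
  sequence of queries, so a query may write to memory but has to leave the image as it found it.
\<close>

definition serves ::
  "int \<Rightarrow> com \<Rightarrow> memory \<Rightarrow> nat \<Rightarrow> nat \<Rightarrow> (cell \<times> cell \<times> cell) set \<Rightarrow> bool" where
  "serves B c M S T Q \<longleftrightarrow>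
     (\<forall>i. fits B (M i)) \<and>
     (\<forall>i\<ge>S. M i = Word 0) \<and>
     (\<forall>(u, v, r)\<in>Q. \<exists>t regs. t \<le> T \<and> regs 0 = r \<and> exec B c (query_regs u v, M) t (regs, M))"

text \<open>
  One query program has to work for all inputs.  No bound is put on the time for building the
  structure.
\<close>

definition has_structure :: "'d data_problem \<Rightarrow> (nat \<Rightarrow> real) \<Rightarrow> (nat \<Rightarrow> real) \<Rightarrow> bool" where
  "has_structure \<Pi> space time \<longleftrightarrow>
     (\<exists>c (e::nat) (S::nat \<Rightarrow> nat) (T::nat \<Rightarrow> nat).
        (\<lambda>n. real (S n)) \<in> soft_O space \<and> (\<lambda>n. real (T n)) \<in> soft_O time \<and>
        (\<forall>d. valid_data \<Pi> d \<longrightarrow>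
           (\<exists>M. serves ((int (word_size \<Pi> d) + 2) ^ e) c M
                  (S (data_size \<Pi> d)) (T (data_size \<Pi> d)) (queries \<Pi> d))))"


section \<open>Range subgraph counting\<close>

type_synonym 'v graph = "'v set \<times> 'v set set"

definition is_graph :: "'v graph \<Rightarrow> bool" where
  "is_graph G \<longleftrightarrow> finite (fst G) \<and> (\<forall>e\<in>snd G. e \<subseteq> fst G \<and> card e = 2)"

definition subgraph_of :: "'v graph \<Rightarrow> 'v graph \<Rightarrow> bool" where
  "subgraph_of H G \<longleftrightarrow> is_graph H \<and> fst H \<subseteq> fst G \<and> snd H \<subseteq> snd G"

definition isomorphic :: "'v graph \<Rightarrow> 'w graph \<Rightarrow> bool" where
  "isomorphic H Q \<longleftrightarrow> (\<exists>f. bij_betw f (fst H) (fst Q) \<and> snd Q = (\<lambda>e. f ` e) ` snd H)"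

definition induced :: "'v graph \<Rightarrow> 'v set \<Rightarrow> 'v graph" where
  "induced G U = (fst G \<inter> U, {e \<in> snd G. e \<subseteq> U})"

definition occurrences :: "'w graph \<Rightarrow> 'v graph \<Rightarrow> 'v graph set" where
  "occurrences Q G = {H. subgraph_of H G \<and> isomorphic H Q}"

definition wedge :: "nat graph" where
  "wedge = ({0, 1, 2}, {{0, 1}, {1, 2}})"

definition range_subgraph_counting :: "'w graph \<Rightarrow> ('v graph \<times> ('v \<Rightarrow> real)) data_problem" where
  "range_subgraph_counting Q =
     \<lparr>valid_data = (\<lambda>(G, A). is_graph G),
      data_size = (\<lambda>(G, A). card (snd G)),
      word_size = (\<lambda>(G, A). card (fst G) + card (snd G)),
      queries = (\<lambda>(G, A).
        {(Real x1, Real x2, Word (int (card (occurrences Q (induced G {v. x1 \<le> A v \<and> A v \<le> x2})))))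
         | x1 x2. x1 \<le> x2})\<rparr>"


section \<open>Set disjointness\<close>

text \<open>Data \<open>(s, S)\<close> stands for the sets \<open>S 1, \<dots>, S s\<close>; the answer is 1 if the two sets are disjoint.\<close>

definition set_disjointness :: "(nat \<times> (nat \<Rightarrow> 'a set)) data_problem" where
  "set_disjointness =
     \<lparr>valid_data = (\<lambda>(s, S). 2 \<le> s \<and> (\<forall>i\<in>{1..s}. finite (S i))),
      data_size = (\<lambda>(s, S). \<Sum>i=1..s. card (S i)),
      word_size = (\<lambda>(s, S). s + (\<Sum>i=1..s. card (S i))),
      queries = (\<lambda>(s, S).
        {(Word (int a), Word (int b), Word (if S a \<inter> S b = {} then 1 else 0))
         | a b. a \<in> {1..s} \<and> b \<in> {1..s} \<and> a \<noteq> b})\<rparr>"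

end

theory Submission
  imports Defs
begin

text \<open>
  Let \<open>I\<close> be the set of incidences \<open>(i, x)\<close> with \<open>x \<in> S i\<close>, so that \<open>card I = N\<close>.  For \<open>L, R \<subseteq> I\<close>
  take a graph with element vertices at position 0, a left copy of set \<open>i\<close> at \<open>- i\<close> joined to its
  elements by the incidences in \<open>L\<close>, and a right copy at \<open>i\<close> joined by those in \<open>R\<close>.  In the mixed
  second difference in \<open>a\<close> and \<open>b\<close> of the number of wedges in \<open>[- a, b]\<close>, all wedges cancel except
  those from the left copy of \<open>a\<close> to the right copy of \<open>b\<close>, that is, the \<open>x\<close> with
  \<open>(a, x) \<in> L\<close> and \<open>(b, x) \<in> R\<close>.

  Nothing relates the values of \<open>lam\<close> at different arguments, so each graph must have exactly \<open>N\<close>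
  edges, not \<open>O(N)\<close>.  Therefore \<open>I\<close> is covered by three sets of at most \<open>N / 2\<close> incidences, \<open>L\<close> and
  \<open>R\<close> range over the nine pairs of these sets, and a matching fills up the edges.  The query adds up
  36 wedge counts obtained from nine structures whose memories are interleaved.  Set identifiers
  become attribute values directly, so no table of size \<open>s\<close> is needed.
\<close>

section \<open>Counting wedges\<close>

text \<open>A wedge is determined by its two edges, so wedges are counted as unordered pairs of
  distinct edges with a common vertex, without vertex sets and isomorphisms.\<close>

definition meeting_pairs :: "'v set set \<Rightarrow> 'v set set set" where
  "meeting_pairs E = {P. P \<subseteq> E \<and> (\<exists>e f. P = {e, f} \<and> e \<noteq> f \<and> e \<inter> f \<noteq> {})}"

text \<open>Two distinct edges of size 2 that meet share exactly one vertex, so they form a path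
  with that vertex in the middle. Conversely, every vertex of a wedge lies on an edge, so its edges
  determine it.\<close>

lemma occurrences_wedge:
  assumes G: "is_graph G"
  shows "occurrences wedge G = (\<lambda>P. (\<Union>P, P)) ` meeting_pairs (snd G)" (is "?L = ?R")
proof (intro equalityI subsetI)
  fix H assume "H \<in> ?L"
  then have sub: "subgraph_of H G" and iso: "isomorphic H wedge"
    by (auto simp: occurrences_def)
  from iso obtain f where bij: "bij_betw f (fst H) {0, 1, 2 :: nat}"
    and im: "{{0, 1}, {1, 2 :: nat}} = (\<lambda>e. f ` e) ` snd H"
    by (auto simp: isomorphic_def wedge_def)
  have edges: "\<And>e. e \<in> snd H \<Longrightarrow> e \<subseteq> fst H"
    using sub by (auto simp: subgraph_of_def is_graph_def)
  define g where "g = inv_into (fst H) f"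
  have gf: "g ` f ` e = e" if "e \<subseteq> fst H" for e
    unfolding g_def using that bij by (auto simp: bij_betw_def inv_into_image_cancel)
  have "snd H = (\<lambda>e. g ` e) ` (\<lambda>e. f ` e) ` snd H"
    using gf edges by (auto simp: image_image)
  also have "\<dots> = {{g 0, g 1}, {g 1, g 2}}"
    by (simp flip: im)
  finally have E: "snd H = {{g 0, g 1}, {g 1, g 2}}" .
  have V: "fst H = {g 0, g 1, g 2}"
    using gf[of "fst H"] bij by (auto simp: bij_betw_def)
  have "inj_on g {0, 1, 2}"
    using bij bij_betw_inv_into[OF bij] by (auto simp: g_def bij_betw_def)
  then have "g 0 \<noteq> g 2"
    by (auto simp: inj_on_def)
  then have "{g 0, g 1} \<noteq> {g 1, g 2}"
    by (auto simp: doubleton_eq_iff)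
  then have "snd H \<in> meeting_pairs (snd G)"
    using sub unfolding E meeting_pairs_def subgraph_of_def by blast
  moreover have "H = (\<Union>(snd H), snd H)"
    using E V by (auto simp: prod_eq_iff)
  ultimately show "H \<in> ?R" by blast
next
  fix H assume "H \<in> ?R"
  then obtain e f where ef: "e \<in> snd G" "f \<in> snd G" "e \<noteq> f" "e \<inter> f \<noteq> {}"
    and H: "H = (e \<union> f, {e, f})"
    by (auto simp: meeting_pairs_def)
  from ef G have c: "card e = 2" "card f = 2" "e \<subseteq> fst G" "f \<subseteq> fst G"
    by (auto simp: is_graph_def)
  from ef obtain v where v: "v \<in> e" "v \<in> f" by blast
  obtain u where u: "e = {u, v}" "u \<noteq> v"
    using c(1) v by (auto simp: card_2_iff)
  obtain w where w: "f = {v, w}" "w \<noteq> v"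
    using c(2) v by (auto simp: card_2_iff)
  have "u \<noteq> w" using u w ef by auto
  define h where "h = (\<lambda>x. if x = u then 0 else if x = v then 1 else 2 :: nat)"
  have "bij_betw h (fst H) (fst wedge)"
    using u w \<open>u \<noteq> w\<close> by (auto simp: bij_betw_def inj_on_def h_def H wedge_def)
  moreover have "snd wedge = (\<lambda>e. h ` e) ` snd H"
    using u w \<open>u \<noteq> w\<close> by (auto simp: h_def H wedge_def)
  moreover have "subgraph_of H G"
    using G ef c u w by (auto simp: subgraph_of_def is_graph_def H)
  ultimately show "H \<in> ?L"
    by (auto simp: occurrences_def isomorphic_def)
qed

lemma card_occurrences_wedge:
  "is_graph G \<Longrightarrow> card (occurrences wedge G) = card (meeting_pairs (snd G))"
  by (simp add: occurrences_wedge card_image inj_on_def)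

section \<open>Meeting pairs across a disjoint union of edge sets\<close>

definition meetings :: "'v set set \<Rightarrow> 'v set set \<Rightarrow> nat" where
  "meetings X Y = (\<Sum>e\<in>X. \<Sum>f\<in>Y. if e \<inter> f \<noteq> {} then 1 else 0)"

lemma card_meeting_pairs_Un:
  assumes "finite X" "finite Y" "X \<inter> Y = {}"
  shows "card (meeting_pairs (X \<union> Y)) =
    card (meeting_pairs X) + card (meeting_pairs Y) + meetings X Y"
proof -
  \<comment> \<open>\<open>C\<close> orders each mixed pair with its edge from \<open>X\<close>
    first; as \<open>X\<close> and \<open>Y\<close> are disjoint, forgetting the order is
    injective.\<close>
  define C where "C = {(e, f). e \<in> X \<and> f \<in> Y \<and> e \<inter> f \<noteq> {}}"
  define D where "D = (\<lambda>(e, f). {e, f}) ` C"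
  have fin: "finite (meeting_pairs Z)" if "finite Z" for Z :: "'a set set"
    by (rule finite_subset[of _ "Pow Z"]) (use that in \<open>auto simp: meeting_pairs_def\<close>)
  have CS: "C = (SIGMA e:X. {f \<in> Y. e \<inter> f \<noteq> {}})"
    by (auto simp: C_def)
  have finC: "finite C"
    by (rule finite_subset[of _ "X \<times> Y"]) (use assms in \<open>auto simp: C_def\<close>)
  have "inj_on (\<lambda>(e, f). {e, f}) C"
    using assms(3) by (auto simp: inj_on_def C_def doubleton_eq_iff)
  then have "card D = card C"
    by (simp add: D_def card_image)
  also have "\<dots> = meetings X Y"
    using assms by (simp add: CS meetings_def sum.If_cases Int_def conj_commute)
  finally have cD: "card D = meetings X Y" .
  have eq: "meeting_pairs (X \<union> Y) = (meeting_pairs X \<union> meeting_pairs Y) \<union> D"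
    (is "?L = ?R")
  proof (intro equalityI subsetI)
    fix P assume "P \<in> ?L"
    then obtain e f where P: "P = {e, f}" "e \<noteq> f" "e \<inter> f \<noteq> {}" "e \<in> X \<union> Y" "f \<in> X \<union> Y"
      unfolding meeting_pairs_def by blast
    then consider "e \<in> X" "f \<in> X" | "e \<in> Y" "f \<in> Y" | "(e, f) \<in> C" | "(f, e) \<in> C"
      unfolding C_def by blast
    then show "P \<in> ?R"
    proof cases
      case 1
      then have "P \<in> meeting_pairs X" unfolding meeting_pairs_def using P by blast
      then show ?thesis by simp
    next
      case 2
      then have "P \<in> meeting_pairs Y" unfolding meeting_pairs_def using P by blast
      then show ?thesis by simp
    next
      case 3
      then have "P \<in> D" unfolding D_def P(1) by (rule rev_image_eqI) simp
      then show ?thesis by simp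
    next
      case 4
      then have "P \<in> D" unfolding D_def P(1) by (rule rev_image_eqI) (simp add: insert_commute)
      then show ?thesis by simp
    qed
  next
    fix P assume "P \<in> ?R"
    then consider "P \<in> meeting_pairs X" | "P \<in> meeting_pairs Y"
      | e f where "P = {e, f}" "e \<in> X" "f \<in> Y" "e \<inter> f \<noteq> {}"
      by (auto simp: D_def C_def)
    then show "P \<in> ?L"
    proof cases
      case 3
      then have "e \<noteq> f" using assms(3) by auto
      with 3 show ?thesis unfolding meeting_pairs_def by blast
    qed (auto simp: meeting_pairs_def)
  qed
  have "meeting_pairs X \<inter> meeting_pairs Y = {}"
    using assms(3) by (auto simp: meeting_pairs_def)
  moreover have "(meeting_pairs X \<union> meeting_pairs Y) \<inter> D = {}"
    using assms(3) by (auto simp: meeting_pairs_def D_def C_def)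
  moreover have "finite D"
    using finC by (simp add: D_def)
  ultimately show ?thesis
    unfolding eq using fin assms by (simp add: card_Un_disjoint cD)
qed

lemma meetings_Un_left:
  "finite X \<Longrightarrow> finite X' \<Longrightarrow> X \<inter> X' = {} \<Longrightarrow> meetings (X \<union> X') Y = meetings X Y + meetings X' Y"
  by (simp add: meetings_def sum.union_disjoint)

lemma meetings_Un_right:
  "finite Y \<Longrightarrow> finite Y' \<Longrightarrow> Y \<inter> Y' = {} \<Longrightarrow> meetings X (Y \<union> Y') = meetings X Y + meetings X Y'"
  by (simp add: meetings_def sum.union_disjoint sum.distrib)

text \<open>The number of meeting pairs behaves like a quadratic form with polarisation
  \<open>meetings\<close>. Pairs inside one side cancel, and of the bilinear term only the value at
  the increments \<open>X'\<close> and \<open>Y'\<close> survives.\<close>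

lemma mixed_difference_meeting_pairs:
  assumes "finite X" "finite Y" "finite X'" "finite Y'"
    and "(X \<union> X') \<inter> (Y \<union> Y') = {}" "X \<inter> X' = {}" "Y \<inter> Y' = {}"
  shows "int (card (meeting_pairs ((X \<union> X') \<union> (Y \<union> Y')))) - int (card (meeting_pairs (X \<union> (Y \<union> Y'))))
     - int (card (meeting_pairs ((X \<union> X') \<union> Y))) + int (card (meeting_pairs (X \<union> Y)))
    = int (meetings X' Y')"
proof -
  have "X \<inter> (Y \<union> Y') = {}" "(X \<union> X') \<inter> Y = {}" "X \<inter> Y = {}"
    using assms(5) by auto
  with assms show ?thesis
    by (simp add: card_meeting_pairs_Un[of _ "Y \<union> Y'"] card_meeting_pairs_Un[of _ Y]
        meetings_Un_left meetings_Un_right)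
qed

section \<open>Incidence graphs\<close>

text \<open>The residue modulo 5 is the kind of a vertex: 0 for elements, 1 and 2 for left and right
  copies of sets, 3 and 4 for the ends of a padding edge. Hence padding edges meet no other
  edge.\<close>

definition left_edge :: "nat \<times> nat \<Rightarrow> nat set" where
  "left_edge = (\<lambda>(i, x). {5 * i + 1, 5 * x})"

definition right_edge :: "nat \<times> nat \<Rightarrow> nat set" where
  "right_edge = (\<lambda>(i, x). {5 * i + 2, 5 * x})"

definition pad_edge :: "nat \<Rightarrow> nat set" where
  "pad_edge k = {5 * k + 3, 5 * k + 4}"

text \<open>The vertex set does not depend on \<open>L\<close>, \<open>R\<close> and
  \<open>m\<close>, which fixes the number of vertices. Padding is grouped with the left edges, so
  that the edges split into the two sides of the mixed difference.\<close>

definition incidence_graph :: "nat \<Rightarrow> nat \<Rightarrow> (nat \<times> nat) set \<Rightarrow> (nat \<times> nat) set \<Rightarrow> nat graph" where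
  "incidence_graph n m L R =
     ({..<5 * (n + 1)}, (pad_edge ` {..<m} \<union> left_edge ` L) \<union> right_edge ` R)"

definition position :: "nat \<Rightarrow> real" where
  "position v = (if v mod 5 = 1 then - real (v div 5) else if v mod 5 = 2 then real (v div 5) else 0)"

lemma position_simps [simp]:
  "position (5 * i) = 0" "position (Suc (5 * i)) = - real i"
  "position (Suc (Suc (5 * i))) = real i" "position (5 * i + 2) = real i"
  "position (5 * i + 3) = 0" "position (5 * i + 4) = 0"
  by (auto simp: position_def mod_Suc mod_add_left_eq[symmetric] mod_mult_self4)

lemma inj_edges: "inj_on left_edge X" "inj_on right_edge X" "inj_on pad_edge Y"
  by (auto simp: inj_on_def left_edge_def right_edge_def pad_edge_def doubleton_eq_iff) presburger+

lemma edges_disjoint: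
  "left_edge ` L \<inter> right_edge ` R = {}" "pad_edge ` K \<inter> left_edge ` L = {}"
  "pad_edge ` K \<inter> right_edge ` R = {}"
  by (auto simp: left_edge_def right_edge_def pad_edge_def doubleton_eq_iff) presburger+

lemma is_graph_incidence_graph:
  assumes "L \<subseteq> {1..n} \<times> {..<n}" "R \<subseteq> {1..n} \<times> {..<n}" "m \<le> n"
  shows "is_graph (incidence_graph n m L R)"
proof -
  have "5 * i + 1 \<noteq> 5 * x" "5 * i + 2 \<noteq> 5 * x" for i x :: nat
    by presburger+
  then show ?thesis
    using assms
    by (fastforce simp: is_graph_def incidence_graph_def left_edge_def right_edge_def pad_edge_def
        card_insert_if)
qed

lemma card_edges_incidence_graph:
  assumes "finite L" "finite R"
  shows "card (snd (incidence_graph n m L R)) = card L + card R + m"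
proof -
  have "(pad_edge ` {..<m} \<union> left_edge ` L) \<inter> right_edge ` R = {}"
    by (simp add: Int_Un_distrib2 edges_disjoint)
  then show ?thesis
    using assms
    by (simp add: incidence_graph_def card_Un_disjoint edges_disjoint card_image inj_edges)
qed

text \<open>The interval contains 0 and with it all elements and padding. Left copies always satisfy
  the upper bound and right copies the lower one, so each endpoint selects edges on its own side
  only.\<close>

lemma induced_edges_incidence_graph:
  "snd (induced (incidence_graph n m L R) {v. - real x \<le> position v \<and> position v \<le> real y}) =
    (pad_edge ` {..<m} \<union> left_edge ` {p \<in> L. fst p \<le> x}) \<union> right_edge ` {p \<in> R. fst p \<le> y}"
  by (auto simp: incidence_graph_def induced_def left_edge_def right_edge_def pad_edge_def image_iff)

definition wedge_count :: "nat graph \<Rightarrow> int \<Rightarrow> int \<Rightarrow> int" where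
  "wedge_count G x y =
     int (card (occurrences wedge (induced G {v. of_int x \<le> position v \<and> position v \<le> of_int y})))"

lemma is_graph_induced: "is_graph G \<Longrightarrow> is_graph (induced G U)"
  by (auto simp: is_graph_def induced_def)

text \<open>Moving the left endpoint out to \<open>- a\<close> adds exactly the left edges of set
  \<open>a\<close>, and likewise on the right for \<open>b\<close>, so \<open>D\<close> is the
  number of meetings between these increments. Nonnegativity rules out cancellation when several
  graphs are added up.\<close>

lemma mixed_difference_wedge_count:
  fixes a b n m :: nat
  assumes LR: "L \<subseteq> {1..n} \<times> {..<n}" "R \<subseteq> {1..n} \<times> {..<n}" "m \<le> n" and ab: "1 \<le> a" "1 \<le> b"
  defines "C \<equiv> wedge_count (incidence_graph n m L R)"
  defines "D \<equiv> C (- int a) (int b) - C (1 - int a) (int b) - C (- int a) (int b - 1)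
    + C (1 - int a) (int b - 1)"
  shows "0 \<le> D" and "0 < D \<longleftrightarrow> (\<exists>x. (a, x) \<in> L \<and> (b, x) \<in> R)"
proof -
  define X where "X x = pad_edge ` {..<m} \<union> left_edge ` {p \<in> L. fst p \<le> x}" for x
  define Y where "Y y = right_edge ` {p \<in> R. fst p \<le> y}" for y
  define X' where "X' = left_edge ` {p \<in> L. fst p = a}"
  define Y' where "Y' = right_edge ` {p \<in> R. fst p = b}"
  have finLR: "finite L" "finite R"
    using LR(1,2) by (auto intro: finite_subset)
  have C: "C (- int x) (int y) = int (card (meeting_pairs (X x \<union> Y y)))" for x y
  proof -
    have "C (- int x) (int y) = int (card (meeting_pairs (snd
        (induced (incidence_graph n m L R) {v. - real x \<le> position v \<and> position v \<le> real y}))))"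
      unfolding C_def wedge_count_def
      by (subst card_occurrences_wedge)
        (auto intro!: is_graph_induced is_graph_incidence_graph LR)
    then show ?thesis
      by (simp only: induced_edges_incidence_graph X_def Y_def)
  qed
  \<comment> \<open>Identifiers start at 1, which makes the truncated subtraction
    \<open>c - 1\<close> exact.\<close>
  have le: "{p \<in> Z. fst p \<le> c} = {p \<in> Z. fst p \<le> c - 1} \<union> {p \<in> Z. fst p = c}" if "1 \<le> c"
    for Z :: "(nat \<times> nat) set" and c
    using that by auto
  have Xa: "X a = X (a - 1) \<union> X'"
    unfolding X_def X'_def le[OF ab(1)] by (simp only: image_Un Un_assoc)
  have Yb: "Y b = Y (b - 1) \<union> Y'"
    unfolding Y_def Y'_def le[OF ab(2)] by (simp only: image_Un)
  have fin: "finite (X (a - 1))" "finite X'" "finite (Y (b - 1))" "finite Y'"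
    using finLR by (auto simp: X_def X'_def Y_def Y'_def)
  have "X a \<inter> Y b = {}"
    using edges_disjoint by (simp add: X_def Y_def Int_Un_distrib2)
  then have disj: "(X (a - 1) \<union> X') \<inter> (Y (b - 1) \<union> Y') = {}"
    using Xa Yb by simp
  have "left_edge ` {p \<in> L. fst p \<le> a - 1} \<inter> X' = {}"
    unfolding X'_def by (subst inj_on_image_Int[OF inj_edges(1)[of UNIV], symmetric]) (use ab in auto)
  then have X': "X (a - 1) \<inter> X' = {}"
    using edges_disjoint by (simp add: X_def X'_def Int_Un_distrib2)
  have Y': "Y (b - 1) \<inter> Y' = {}"
    unfolding Y_def Y'_def
    by (subst inj_on_image_Int[OF inj_edges(2)[of UNIV], symmetric]) (use ab in auto)
  have "D = int (meetings X' Y')"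
    using mixed_difference_meeting_pairs[OF fin(1,3,2,4) disj X' Y'] C[of a b] C[of "a - 1" b]
      C[of a "b - 1"] C[of "a - 1" "b - 1"] ab
    by (simp add: D_def Xa Yb of_nat_diff)
  moreover have "0 < meetings X' Y' \<longleftrightarrow> (\<exists>e\<in>X'. \<exists>f\<in>Y'. e \<inter> f \<noteq> {})"
    using fin by (auto simp: meetings_def sum_eq_0_iff simp flip: neq0_conv split: if_splits)
  moreover have X'_eq: "X' = (\<lambda>x. left_edge (a, x)) ` {x. (a, x) \<in> L}"
    unfolding X'_def image_def by (rule Collect_cong) (metis (mono_tags) eq_fst_iff fst_conv mem_Collect_eq)
  moreover have Y'_eq: "Y' = (\<lambda>x. right_edge (b, x)) ` {x. (b, x) \<in> R}"
    unfolding Y'_def image_def by (rule Collect_cong) (metis (mono_tags) eq_fst_iff fst_conv mem_Collect_eq)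
  \<comment> \<open>The copies of \<open>a\<close> and \<open>b\<close> have residues 1 and 2, so a
    common vertex can only be an element.\<close>
  moreover have "left_edge (a, x) \<inter> right_edge (b, y) \<noteq> {} \<longleftrightarrow> x = y" for x y
    unfolding left_edge_def right_edge_def by (auto, presburger+)
  then have "(\<exists>e\<in>X'. \<exists>f\<in>Y'. e \<inter> f \<noteq> {}) \<longleftrightarrow> (\<exists>x. (a, x) \<in> L \<and> (b, x) \<in> R)"
    unfolding X'_eq Y'_eq by auto
  ultimately show "0 \<le> D" "0 < D \<longleftrightarrow> (\<exists>x. (a, x) \<in> L \<and> (b, x) \<in> R)"
    by simp_all
qed

section \<open>Graphs with a prescribed number of edges for Set Disjointness\<close>

lemma cover_by_three_halves:
  assumes "finite I" "2 \<le> card I"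
  obtains P :: "nat \<Rightarrow> 'a set" where
    "\<And>p. P p \<subseteq> I" "\<And>p. 2 * card (P p) \<le> card I" "(\<Union>p<3. P p) = I"
proof -
  define h where "h = card I div 2"
  obtain P0 where P0: "P0 \<subseteq> I" "card P0 = h"
    using obtain_subset_with_card_n[of h I] by (auto simp: h_def)
  have c: "card (I - P0) = card I - h"
    using P0 assms by (simp add: card_Diff_subset finite_subset)
  then have "h \<le> card (I - P0)" by (simp add: h_def)
  then obtain P1 where P1: "P1 \<subseteq> I - P0" "card P1 = h"
    using obtain_subset_with_card_n by blast
  have "card (I - P0 - P1) = card I - h - h"
    using P0 P1 c assms by (simp add: card_Diff_subset finite_subset)
  \<comment> \<open>Two parts of size \<open>card I div 2\<close> leave at most one element, and
    twice that is within the bound because \<open>card I\<close> is at least 2.\<close>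
  then have P2: "2 * card (I - P0 - P1) \<le> card I"
    using assms(2) unfolding h_def by linarith
  define P where "P = (\<lambda>p :: nat. if p = 0 then P0 else if p = 1 then P1 else I - P0 - P1 :: 'a set)"
  show ?thesis
  proof
    show "P p \<subseteq> I" for p using P0 P1 by (auto simp: P_def)
    show "2 * card (P p) \<le> card I" for p
      using P0 P1 P2 by (auto simp: P_def h_def)
    show "(\<Union>p<3. P p) = I"
      using P0 P1 by (auto simp: P_def numeral_3_eq_3 lessThan_Suc)
  qed
qed

text \<open>With exactly \<open>N\<close> edges, the bounds of the assumed structure are evaluated
  at \<open>N\<close> itself. An element shared by \<open>a\<close> and \<open>b\<close> shows up in
  the graph for the parts containing its two incidences, and as no difference is negative, one
  positive difference makes the sum positive.\<close>

lemma set_disjointness_graphs: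
  fixes S :: "nat \<Rightarrow> 'a set"
  assumes fin: "\<And>i. i \<in> {1..s} \<Longrightarrow> finite (S i)"
  defines "N \<equiv> \<Sum>i=1..s. card (S i)"
  obtains G :: "nat \<Rightarrow> nat graph" where
    "\<And>j. is_graph (G j)" "\<And>j. card (snd (G j)) = N" "\<And>j. card (fst (G j)) = 5 * (s + N + 1)"
    "\<And>a b. a \<in> {1..s} \<Longrightarrow> b \<in> {1..s} \<Longrightarrow> a \<noteq> b \<Longrightarrow>
      (\<Sum>j<9. wedge_count (G j) (- int a) (int b) - wedge_count (G j) (1 - int a) (int b)
        - wedge_count (G j) (- int a) (int b - 1) + wedge_count (G j) (1 - int a) (int b - 1)) > 0
      \<longleftrightarrow> S a \<inter> S b \<noteq> {}"
proof -
  define U where "U = (\<Union>i\<in>{1..s}. S i)"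
  have finU: "finite U" using fin by (auto simp: U_def)
  have cardU: "card U \<le> N"
    unfolding U_def N_def by (rule card_UN_le) simp
  obtain f where f: "bij_betw f U {..<card U}"
    using ex_bij_betw_finite_nat[OF finU] by (auto simp: atLeast0LessThan)
  define I where "I = (SIGMA i:{1..s}. f ` S i)"
  have injU: "inj_on f A" if "A \<subseteq> U" for A
    using f that unfolding bij_betw_def by (blast intro: inj_on_subset)
  have inj: "inj_on f (S i)" if "i \<in> {1..s}" for i
    using that by (intro injU) (auto simp: U_def)
  have cardI: "card I = N"
    using fin by (simp add: I_def N_def card_image inj)
  have finI: "finite I" using fin by (auto simp: I_def)
  have I: "I \<subseteq> {1..s + N} \<times> {..<s + N}"
  proof -
    have "f x < s + N" if "x \<in> U" for x
      using bij_betwE[OF f] that cardU by fastforce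
    then show ?thesis
      by (auto simp: I_def U_def)
  qed
  have meet: "(\<exists>x. (a, x) \<in> I \<and> (b, x) \<in> I) \<longleftrightarrow> S a \<inter> S b \<noteq> {}" if "a \<in> {1..s}" "b \<in> {1..s}" for a b
  proof -
    have "inj_on f (S a \<union> S b)"
      using that by (intro injU) (auto simp: U_def)
    then have "f ` S a \<inter> f ` S b = f ` (S a \<inter> S b)"
      by (simp add: inj_on_image_Int)
    then show ?thesis
      using that by (auto simp: I_def)
  qed
  \<comment> \<open>Covering \<open>I\<close> by halves takes \<open>2 \<le> N\<close>. Otherwise
    empty parts do: a common element of two distinct sets accounts for two incidences, so all pairs
    are disjoint.\<close>
  obtain P :: "nat \<Rightarrow> (nat \<times> nat) set" where P: "\<And>p. P p \<subseteq> I" "\<And>p. 2 * card (P p) \<le> N"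
    and cover: "2 \<le> N \<Longrightarrow> (\<Union>p<3. P p) = I"
  proof (cases "2 \<le> N")
    case True
    show ?thesis
      by (rule cover_by_three_halves[OF finI]) (use True that cardI in auto)
  next
    case False
    then show ?thesis using that[of "\<lambda>_. {}"] by simp
  qed
  \<comment> \<open>Index \<open>j\<close> encodes a pair of parts as \<open>3 * p + q\<close>. Each
    part has at most \<open>N / 2\<close> elements, so the truncated subtractions are exact.\<close>
  define m where "m j = N - card (P (j div 3)) - card (P (j mod 3))" for j
  define G where "G j = incidence_graph (s + N) (m j) (P (j div 3)) (P (j mod 3))" for j
  have PI: "P p \<subseteq> {1..s + N} \<times> {..<s + N}" for p
    using P(1) I by blast
  have m: "m j \<le> s + N" for j by (simp add: m_def)
  have fP: "finite (P p)" for p using P(1) finI finite_subset by blast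
  show ?thesis
  proof
    show "is_graph (G j)" for j
      unfolding G_def by (intro is_graph_incidence_graph PI m)
    show "card (snd (G j)) = N" for j
      using P(2)[of "j div 3"] P(2)[of "j mod 3"]
      by (simp add: G_def card_edges_incidence_graph fP m_def)
    show "card (fst (G j)) = 5 * (s + N + 1)" for j
      by (simp add: G_def incidence_graph_def)
    fix a b assume ab: "a \<in> {1..s}" "b \<in> {1..s}" "a \<noteq> b"
    define D where "D j = wedge_count (G j) (- int a) (int b) - wedge_count (G j) (1 - int a) (int b)
        - wedge_count (G j) (- int a) (int b - 1) + wedge_count (G j) (1 - int a) (int b - 1)" for j
    have D: "0 \<le> D j" "0 < D j \<longleftrightarrow> (\<exists>x. (a, x) \<in> P (j div 3) \<and> (b, x) \<in> P (j mod 3))" for j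
      unfolding D_def G_def using mixed_difference_wedge_count[OF PI PI m, of a b] ab by auto
    have "sum D {..<9} > 0 \<longleftrightarrow> (\<exists>j<9. D j > 0)"
      using D(1) by (subst less_le) (auto simp: sum_nonneg sum_nonneg_eq_0_iff less_le)
    also have "\<dots> \<longleftrightarrow> (\<exists>p<3. \<exists>q<3. \<exists>x. (a, x) \<in> P p \<and> (b, x) \<in> P q)"
    proof
      assume "\<exists>j<9. D j > 0"
      then obtain j where j: "j < 9" "D j > 0" by blast
      then have "j div 3 < 3" "j mod 3 < 3" by auto
      then show "\<exists>p<3. \<exists>q<3. \<exists>x. (a, x) \<in> P p \<and> (b, x) \<in> P q"
        using D(2)[of j] j(2) by blast
    next
      assume "\<exists>p<3. \<exists>q<3. \<exists>x. (a, x) \<in> P p \<and> (b, x) \<in> P q"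
      then obtain p q where "p < 3" "q < 3" "\<exists>x. (a, x) \<in> P p \<and> (b, x) \<in> P q" by blast
      then show "\<exists>j<9. D j > 0"
        using D(2)[of "3 * p + q"] by (intro exI[of _ "3 * p + q"]) auto
    qed
    also have "\<dots> \<longleftrightarrow> (\<exists>x. (a, x) \<in> I \<and> (b, x) \<in> I)"
    proof (cases "2 \<le> N")
      case True
      show ?thesis using cover[OF True] by blast
    next
      case False
      have "\<not> (\<exists>x. (a, x) \<in> I \<and> (b, x) \<in> I)"
      proof
        assume "\<exists>x. (a, x) \<in> I \<and> (b, x) \<in> I"
        then obtain x where "{(a, x), (b, x)} \<subseteq> I" by auto
        from card_mono[OF finI this] show False using False ab(3) cardI by simp
      qed
      then show ?thesis using P(1) by blast
    qed
    finally show "(\<Sum>j<9. wedge_count (G j) (- int a) (int b) - wedge_count (G j) (1 - int a) (int b)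
        - wedge_count (G j) (- int a) (int b - 1) + wedge_count (G j) (1 - int a) (int b - 1)) > 0
      \<longleftrightarrow> S a \<inter> S b \<noteq> {}"
      using meet[OF ab(1,2)] by (simp add: D_def)
  qed
qed

section \<open>Relocating programs\<close>

fun seq :: "instr list \<Rightarrow> com" where
  "seq [] = Skip"
| "seq (i # is) = Seq (Basic i) (seq is)"

fun steps :: "int \<Rightarrow> instr list \<Rightarrow> state \<Rightarrow> state option" where
  "steps B [] s = Some s"
| "steps B (i # is) s = Option.bind (step B i s) (steps B is)"

lemma exec_seq: "steps B is s = Some s' \<Longrightarrow> exec B (seq is) s (length is) s'"
proof (induction "is" arbitrary: s)
  case Nil
  then show ?case by (auto intro: exec.Skip)
next
  case (Cons i "is")
  then obtain s1 where "step B i s = Some s1" "steps B is s1 = Some s'"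
    by (auto simp: bind_eq_Some_conv)
  with Cons.IH have "exec B (Seq (Basic i) (seq is)) s (1 + length is) s'"
    by (intro exec.Seq exec.Basic)
  then show ?case by simp
qed

lemma steps_append: "steps B (is @ js) s = Option.bind (steps B is s) (steps B js)"
proof (induction "is" arbitrary: s)
  case (Cons i "is")
  then show ?case by (cases "step B i s") auto
qed simp

lemma fits_mono: "fits B v \<Longrightarrow> B \<le> B' \<Longrightarrow> fits B' v"
  by (cases v) auto

text \<open>
  Register \<open>r\<close> moves to \<open>\<rho> r\<close> and address \<open>a\<close> to \<open>K * a + j\<close>, so that several programs can
  share one machine; registers 4 and 5 are scratch space for the address computation.
\<close>

locale relocation =
  fixes \<rho> :: "nat \<Rightarrow> nat" and K j :: nat and B B' :: int
  assumes inj_\<rho>: "inj \<rho>" and \<rho>_ge: "6 \<le> \<rho> r" and j_less: "j < K"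
    and bound: "int K * (B + 1) \<le> B'" and B_nonneg: "0 \<le> B"
begin

lemma B_le: "B \<le> B'"
proof -
  have "1 * (B + 1) \<le> int K * (B + 1)"
    using j_less B_nonneg by (intro mult_right_mono) auto
  with bound show ?thesis by simp
qed

lemma K_le: "int K \<le> B'"
proof -
  have "int K * 1 \<le> int K * (B + 1)"
    using B_nonneg by (intro mult_left_mono) auto
  with bound show ?thesis by simp
qed

definition addr :: "nat \<Rightarrow> instr list" where
  "addr p = [Const 4 (int K), Alu Mul 4 (\<rho> p) 4, Const 5 (int j), Alu Add 4 4 5]"

fun reloc_instr :: "instr \<Rightarrow> instr list" where
  "reloc_instr (Const x a) = [Const (\<rho> x) a]"
| "reloc_instr (Copy x y) = [Copy (\<rho> x) (\<rho> y)]"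
| "reloc_instr (Alu f x y z) = [Alu f (\<rho> x) (\<rho> y) (\<rho> z)]"
| "reloc_instr (To_Real x y) = [To_Real (\<rho> x) (\<rho> y)]"
| "reloc_instr (Load x p) = addr p @ [Load (\<rho> x) 4]"
| "reloc_instr (Store p y) = addr p @ [Store 4 (\<rho> y)]"

fun reloc :: "com \<Rightarrow> com" where
  "reloc Skip = Skip"
| "reloc (Basic i) = seq (reloc_instr i)"
| "reloc (Seq c d) = Seq (reloc c) (reloc d)"
| "reloc (Branch x y c d) = Branch (\<rho> x) (\<rho> y) (reloc c) (reloc d)"
| "reloc (While x y c) = While (\<rho> x) (\<rho> y) (reloc c)"

text \<open>The \<open>fits\<close> clauses are invariants of the original run; they bound the
  addresses to be translated and, at the end, the answer.\<close>

definition sim :: "state \<Rightarrow> state \<Rightarrow> bool" where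
  "sim s \<sigma> \<longleftrightarrow> (\<forall>r. fst \<sigma> (\<rho> r) = fst s r \<and> fits B (fst s r)) \<and>
     (\<forall>a. snd \<sigma> (K * a + j) = snd s a \<and> fits B (snd s a))"

text \<open>This is what the other programs on the machine rely on: their registers and their
  residue classes of addresses stay untouched.\<close>

definition frame :: "state \<Rightarrow> state \<Rightarrow> bool" where
  "frame \<sigma> \<sigma>' \<longleftrightarrow> (\<forall>r. r \<notin> range \<rho> \<longrightarrow> r \<noteq> 4 \<longrightarrow> r \<noteq> 5 \<longrightarrow> fst \<sigma>' r = fst \<sigma> r) \<and>
     (\<forall>a. a mod K \<noteq> j \<longrightarrow> snd \<sigma>' a = snd \<sigma> a)"

lemma frame_refl: "frame \<sigma> \<sigma>" and frame_trans: "frame \<sigma> \<sigma>' \<Longrightarrow> frame \<sigma>' \<sigma>'' \<Longrightarrow> frame \<sigma> \<sigma>''"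
  by (auto simp: frame_def)

lemma \<rho>_eq [simp]: "\<rho> x = \<rho> y \<longleftrightarrow> x = y"
  using inj_\<rho> by (auto simp: inj_def)

lemma \<rho>_tmp [simp]: "\<rho> x \<noteq> 4" "\<rho> x \<noteq> 5"
  using \<rho>_ge[of x] by auto

lemma sim_set_reg:
  assumes "set_reg B x v s = Some s'" "sim s \<sigma>"
  shows "\<exists>\<sigma>'. set_reg B' (\<rho> x) v \<sigma> = Some \<sigma>' \<and> sim s' \<sigma>' \<and> frame \<sigma> \<sigma>'"
  using assms fits_mono[OF _ B_le]
  by (auto simp: set_reg_def sim_def frame_def split: if_splits)

text \<open>An address held in a register is at most \<open>B\<close>, so its translation is at most
  \<open>K * B + K\<close>, which \<open>bound\<close> keeps within \<open>B'\<close>.\<close>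

lemma sim_addr:
  assumes sim: "sim s \<sigma>" and p: "fst s p = Word a" and a: "0 \<le> a"
  shows "\<exists>\<sigma>'. steps B' (addr p) \<sigma> = Some \<sigma>' \<and> sim s \<sigma>' \<and> frame \<sigma> \<sigma>' \<and>
    fst \<sigma>' 4 = Word (int K * a + int j)"
proof -
  have fa: "\<bar>a\<bar> \<le> B" and \<sigma>p: "fst \<sigma> (\<rho> p) = Word a"
    using sim p unfolding sim_def by (metis fits.simps(1))+
  have "int K * a + int j \<le> int K * B + int K"
    using fa a j_less by (intro add_mono mult_left_mono) auto
  also have "\<dots> \<le> B'"
    using bound by (simp add: algebra_simps)
  finally have le: "int K * a + int j \<le> B'" .
  moreover have "0 \<le> int K * a" using a by simp
  moreover have "steps B' (addr p) \<sigma> =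
      Some ((fst \<sigma>)(4 := Word (int K * a + int j), 5 := Word (int j)), snd \<sigma>)"
    using K_le j_less \<sigma>p le \<open>0 \<le> int K * a\<close>
    by (simp add: addr_def set_reg_def mult.commute fun_upd_twist)
  ultimately show ?thesis
    using sim by (auto simp: sim_def frame_def)
qed

lemma sim_step:
  assumes "step B i s = Some s'" and sim: "sim s \<sigma>"
  shows "\<exists>\<sigma>'. steps B' (reloc_instr i) \<sigma> = Some \<sigma>' \<and> sim s' \<sigma>' \<and> frame \<sigma> \<sigma>'"
proof -
  have regs: "\<And>r. fst \<sigma> (\<rho> r) = fst s r" and mem: "\<And>a. snd \<sigma> (K * a + j) = snd s a"
    using sim by (auto simp: sim_def)
  have nat_addr: "nat (int K * a + int j) = K * nat a + j" if "0 \<le> a" for a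
    using that by (simp add: nat_add_distrib nat_mult_distrib)
  show ?thesis
  proof (cases i)
    case (Load x p)
    then obtain a where a: "fst s p = Word a" "0 \<le> a" "set_reg B x (snd s (nat a)) s = Some s'"
      using assms by (auto split: cell.splits if_splits)
    obtain \<sigma>1 where 1: "steps B' (addr p) \<sigma> = Some \<sigma>1" "sim s \<sigma>1" "frame \<sigma> \<sigma>1"
        "fst \<sigma>1 4 = Word (int K * a + int j)"
      using sim_addr[OF sim a(1,2)] by blast
    have m1: "snd \<sigma>1 (K * nat a + j) = snd s (nat a)"
      using 1 by (auto simp: sim_def)
    show ?thesis
      using sim_set_reg[OF a(3) 1(2)] 1 a(2) m1 frame_trans[OF 1(3)]
      by (auto simp: Load steps_append nat_addr)
  next
    case (Store p y)
    then obtain a where a: "fst s p = Word a" "0 \<le> a" "s' = (fst s, (snd s)(nat a := fst s y))"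
      using assms by (auto split: cell.splits if_splits)
    obtain \<sigma>1 where 1: "steps B' (addr p) \<sigma> = Some \<sigma>1" "sim s \<sigma>1" "frame \<sigma> \<sigma>1"
        "fst \<sigma>1 4 = Word (int K * a + int j)"
      using sim_addr[OF sim a(1,2)] by blast
    let ?\<sigma>' = "(fst \<sigma>1, (snd \<sigma>1)(K * nat a + j := fst s y))"
    have "fst \<sigma>1 (\<rho> y) = fst s y"
      using 1 by (auto simp: sim_def)
    then have "steps B' (reloc_instr i) \<sigma> = Some ?\<sigma>'"
      using 1 a by (simp add: Store steps_append nat_addr)
    moreover have "sim s' ?\<sigma>'"
      using 1(2) j_less by (auto simp: sim_def a(3))
    moreover have "frame \<sigma>1 ?\<sigma>'"
      using j_less by (auto simp: frame_def)
    ultimately show ?thesis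
      using frame_trans[OF 1(3)] by blast
  next
    case (Const x a)
    then have "set_reg B x (Word a) s = Some s'" using assms by simp
    then show ?thesis using sim_set_reg[OF _ sim] by (fastforce simp: Const)
  next
    case (Copy x y)
    then have "set_reg B x (fst s y) s = Some s'" using assms by simp
    then show ?thesis using sim_set_reg[OF _ sim] by (fastforce simp: Copy regs)
  next
    case (Alu f x y z)
    then obtain a b where "fst s y = Word a" "fst s z = Word b"
        "set_reg B x (Word (alu f a b)) s = Some s'"
      using assms by (auto split: cell.splits)
    then show ?thesis using sim_set_reg[OF _ sim] by (fastforce simp: Alu regs)
  next
    case (To_Real x y)
    then obtain a where "fst s y = Word a" "set_reg B x (Real (of_int a)) s = Some s'"
      using assms by (auto split: cell.splits)
    then show ?thesis using sim_set_reg[OF _ sim] by (fastforce simp: To_Real regs)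
  qed
qed

lemma length_reloc_instr: "length (reloc_instr i) \<le> 5"
  by (cases i) (auto simp: addr_def)

text \<open>By induction on the run. An instruction becomes at most five, four of them computing an
  address; tests carry over one to one because renamed registers hold the same cells.\<close>

lemma sim_exec:
  assumes "exec B c s t s'" "sim s \<sigma>"
  shows "\<exists>t' \<sigma>'. t' \<le> 5 * t \<and> exec B' (reloc c) \<sigma> t' \<sigma>' \<and> sim s' \<sigma>' \<and> frame \<sigma> \<sigma>'"
  using assms
proof (induction arbitrary: \<sigma> rule: exec.induct)
  case (Skip s)
  then show ?case
    by (intro exI[of _ 0] exI[of _ \<sigma>]) (simp add: exec.Skip frame_refl)
next
  case (Basic i s s')
  then obtain \<sigma>' where "steps B' (reloc_instr i) \<sigma> = Some \<sigma>'" "sim s' \<sigma>'" "frame \<sigma> \<sigma>'"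
    using sim_step by blast
  then show ?case
    using exec_seq[of B' "reloc_instr i" \<sigma> \<sigma>'] length_reloc_instr[of i]
    by (intro exI[of _ "length (reloc_instr i)"] exI[of _ \<sigma>']) simp
next
  case (Seq c s t s' d t' s'')
  obtain t1 \<sigma>1 where 1: "t1 \<le> 5 * t" "exec B' (reloc c) \<sigma> t1 \<sigma>1" "sim s' \<sigma>1" "frame \<sigma> \<sigma>1"
    using Seq.IH(1) Seq.prems by blast
  obtain t2 \<sigma>2 where 2: "t2 \<le> 5 * t'" "exec B' (reloc d) \<sigma>1 t2 \<sigma>2" "sim s'' \<sigma>2" "frame \<sigma>1 \<sigma>2"
    using Seq.IH(2) 1(3) by blast
  have "exec B' (reloc (Seq c d)) \<sigma> (t1 + t2) \<sigma>2"
    using 1 2 by (auto intro: exec.Seq)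
  with 1 2 frame_trans[OF 1(4) 2(4)] show ?case
    by (intro exI[of _ "t1 + t2"] exI[of _ \<sigma>2]) simp
next
  case (BranchTrue s x y c t s' d)
  obtain t1 \<sigma>1 where 1: "t1 \<le> 5 * t" "exec B' (reloc c) \<sigma> t1 \<sigma>1" "sim s' \<sigma>1" "frame \<sigma> \<sigma>1"
    using BranchTrue.IH BranchTrue.prems by blast
  have "less_cell (fst \<sigma> (\<rho> x)) (fst \<sigma> (\<rho> y)) = Some True"
    using BranchTrue by (simp add: sim_def)
  then have "exec B' (reloc (Branch x y c d)) \<sigma> (t1 + 1) \<sigma>1"
    unfolding reloc.simps using 1(2) by (rule exec.BranchTrue)
  with 1 show ?case
    by (intro exI[of _ "t1 + 1"] exI[of _ \<sigma>1]) simp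
next
  case (BranchFalse s x y d t s' c)
  obtain t1 \<sigma>1 where 1: "t1 \<le> 5 * t" "exec B' (reloc d) \<sigma> t1 \<sigma>1" "sim s' \<sigma>1" "frame \<sigma> \<sigma>1"
    using BranchFalse.IH BranchFalse.prems by blast
  have "less_cell (fst \<sigma> (\<rho> x)) (fst \<sigma> (\<rho> y)) = Some False"
    using BranchFalse by (simp add: sim_def)
  then have "exec B' (reloc (Branch x y c d)) \<sigma> (t1 + 1) \<sigma>1"
    unfolding reloc.simps using 1(2) by (rule exec.BranchFalse)
  with 1 show ?case
    by (intro exI[of _ "t1 + 1"] exI[of _ \<sigma>1]) simp
next
  case (WhileFalse s x y c)
  then have "less_cell (fst \<sigma> (\<rho> x)) (fst \<sigma> (\<rho> y)) = Some False"
    by (simp add: sim_def)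
  then have "exec B' (reloc (While x y c)) \<sigma> 1 \<sigma>"
    unfolding reloc.simps by (rule exec.WhileFalse)
  with WhileFalse show ?case
    by (intro exI[of _ 1] exI[of _ \<sigma>]) (simp add: frame_refl)
next
  case (WhileTrue s x y c t s' t' s'')
  obtain t1 \<sigma>1 where 1: "t1 \<le> 5 * t" "exec B' (reloc c) \<sigma> t1 \<sigma>1" "sim s' \<sigma>1" "frame \<sigma> \<sigma>1"
    using WhileTrue.IH(1) WhileTrue.prems by blast
  obtain t2 \<sigma>2 where 2: "t2 \<le> 5 * t'" "exec B' (reloc (While x y c)) \<sigma>1 t2 \<sigma>2" "sim s'' \<sigma>2"
      "frame \<sigma>1 \<sigma>2"
    using WhileTrue.IH(2) 1(3) by blast
  have "less_cell (fst \<sigma> (\<rho> x)) (fst \<sigma> (\<rho> y)) = Some True"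
    using WhileTrue by (simp add: sim_def)
  then have "exec B' (reloc (While x y c)) \<sigma> (t1 + t2 + 1) \<sigma>2"
    using exec.WhileTrue[of \<sigma> "\<rho> x" "\<rho> y" B' "reloc c" t1 \<sigma>1 t2 \<sigma>2] 1 2 by simp
  with 1 2 frame_trans[OF 1(4) 2(4)] show ?case
    by (intro exI[of _ "t1 + t2 + 1"] exI[of _ \<sigma>2]) simp
qed

end

section \<open>The query program\<close>

text \<open>Residues modulo 36 separate the register files of the 36 calls; the offset 10 keeps them
  clear of the query inputs, the sum and scratch space.\<close>

definition reg :: "nat \<Rightarrow> nat \<Rightarrow> nat" where
  "reg i r = 36 * r + i + 10"

lemma reg_eq: "i < 36 \<Longrightarrow> k < 36 \<Longrightarrow> reg i r = reg k r' \<longleftrightarrow> i = k \<and> r = r'"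
proof
  assume ik: "i < 36" "k < 36" and eq: "reg i r = reg k r'"
  have "i = (36 * r + i) mod 36" using ik by simp
  also have "\<dots> = (36 * r' + k) mod 36" using eq by (simp add: reg_def)
  also have "\<dots> = k" using ik by simp
  finally show "i = k \<and> r = r'" using eq by (simp add: reg_def)
qed auto

lemma reg_ge: "10 \<le> reg i r"
  by (simp add: reg_def)

text \<open>
  Call \<open>i\<close> goes to graph \<open>i div 4\<close>; bits 0 and 1 of \<open>i\<close> tell whether the left and the right endpoint
  of \<open>[- a, b]\<close> are moved inwards by one.  Each call has its own register file, so it finds its
  registers zero without any reset.  Register 2 accumulates the signed sum.
\<close>

definition call :: "com \<Rightarrow> nat \<Rightarrow> com" where
  "call c i =
     Seq (seq [Const 3 (int (i mod 2)), Alu Sub 3 3 0, To_Real (reg i 0) 3,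
               Const 3 (int (i div 2 mod 2)), Alu Sub 3 1 3, To_Real (reg i 1) 3])
       (Seq (relocation.reloc (reg i) 9 (i div 4) c)
            (Basic (Alu (if i mod 2 = i div 2 mod 2 then Add else Sub) 2 2 (reg i 0))))"

text \<open>The layout matches the address map \<open>K * a + j\<close>. Memories that are zero from
  \<open>S\<close> on give an image that is zero from \<open>K * S\<close> on.\<close>

definition interleave :: "nat \<Rightarrow> (nat \<Rightarrow> memory) \<Rightarrow> memory" where
  "interleave K M p = M (p mod K) (p div K)"

fun calls :: "com \<Rightarrow> nat \<Rightarrow> com" where
  "calls c 0 = Skip"
| "calls c (Suc i) = Seq (calls c i) (call c i)"

definition disjointness_query :: "com \<Rightarrow> com" where
  "disjointness_query c =
     Seq (calls c 36) (Seq (seq [Const 3 0, Const 0 1]) (Branch 3 2 (Basic (Const 0 0)) Skip))"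

text \<open>One query with identifiers \<open>a\<close> and \<open>b\<close>, abstracted from the
  graphs: \<open>w i\<close> is the answer to call \<open>i\<close>. The factor 36 in the bound
  leaves room both for addresses multiplied by 9 and for the sum of 36 answers of size at most
  \<open>B\<close>.\<close>

locale wedge_oracle =
  fixes c :: com and B B' :: int and T :: nat and M :: "nat \<Rightarrow> memory" and a b :: int
    and w :: "nat \<Rightarrow> int"
  assumes B: "1 \<le> B" "36 * (B + 1) \<le> B'" "1 \<le> a" "a \<le> B'" "1 \<le> b" "b \<le> B'"
    and fits_M: "i < 9 \<Longrightarrow> fits B (M i p)"
    and query: "i < 36 \<Longrightarrow> \<exists>t regs. t \<le> T \<and> regs 0 = Word (w i) \<and>
      exec B c (query_regs (Real (of_int (int (i mod 2) - a)))
        (Real (of_int (b - int (i div 2 mod 2)))), M (i div 4)) t (regs, M (i div 4))"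
begin

abbreviation M' :: memory where
  "M' \<equiv> interleave 9 M"

text \<open>The sign is that of the mixed second difference: plus if both endpoints or neither are
  moved.\<close>

definition acc :: "nat \<Rightarrow> int" where
  "acc i = (\<Sum>k<i. if k mod 2 = k div 2 mod 2 then w k else - w k)"

text \<open>Register files of later calls must still be zero, since \<open>query_regs\<close> has
  zeros outside the two inputs.\<close>

definition invariant :: "nat \<Rightarrow> (nat \<Rightarrow> cell) \<Rightarrow> bool" where
  "invariant i regs \<longleftrightarrow> regs 0 = Word a \<and> regs 1 = Word b \<and> regs 2 = Word (acc i) \<and>
     \<bar>acc i\<bar> \<le> int i * B \<and> (\<forall>k<36. i \<le> k \<longrightarrow> (\<forall>r. regs (reg k r) = Word 0))"

text \<open>The 7 extra steps are six for setting up the endpoints and one for adding or subtracting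
  the answer.\<close>

lemma exec_call:
  assumes i: "i < 36" and inv: "invariant i regs"
  shows "\<exists>t regs'. t \<le> 5 * T + 7 \<and> exec B' (call c i) (regs, M') t (regs', M') \<and> invariant (Suc i) regs'"
proof -
  define j where "j = i div 4"
  have j: "j < 9" using i by (simp add: j_def)
  define u v where "u = Real (of_int (int (i mod 2) - a))"
    and "v = Real (of_int (b - int (i div 2 mod 2)))"
  interpret relocation "reg i" 9 j B B'
  proof
    show "inj (reg i)" by (auto simp: inj_def reg_def)
    show "6 \<le> reg i r" for r using reg_ge[of i r] by simp
  qed (use j B in auto)
  define regs1 where "regs1 = regs(3 := Word (b - int (i div 2 mod 2)), reg i 0 := u, reg i 1 := v)"
  have small: "reg k r \<noteq> 0" "reg k r \<noteq> Suc 0" "reg k r \<noteq> 2" "reg k r \<noteq> 3" "reg k r \<noteq> 4" "reg k r \<noteq> 5" for k r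
    using reg_ge[of k r] by auto
  have r01: "regs 0 = Word a" "regs (Suc 0) = Word b" "regs 2 = Word (acc i)"
    using inv by (auto simp: invariant_def)
  have bits: "int (i mod 2) \<le> 1" "0 \<le> int (i mod 2)" "int (i div 2 mod 2) \<le> 1" "0 \<le> int (i div 2 mod 2)"
    by auto
  define setup_code where "setup_code = [Const 3 (int (i mod 2)), Alu Sub 3 3 0, To_Real (reg i 0) 3,
    Const 3 (int (i div 2 mod 2)), Alu Sub 3 1 3, To_Real (reg i 1) 3]"
  have "steps B' setup_code (regs, M') = Some (regs1, M')"
    using B bits small small[symmetric] r01
    by (simp add: setup_code_def set_reg_def regs1_def u_def v_def abs_le_iff fun_upd_twist
        del: of_nat_mod)
  moreover have "length setup_code = 6"
    by (simp add: setup_code_def)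
  ultimately have prep: "exec B' (seq setup_code) (regs, M') 6 (regs1, M')"
    using exec_seq by metis
  have sim: "sim (query_regs u v, M j) (regs1, M')"
    unfolding sim_def fst_conv snd_conv
  proof (intro conjI allI)
    show "regs1 (reg i r) = query_regs u v r" for r
      using inv i small(4)[of i r] by (simp add: regs1_def query_regs_def invariant_def)
    show "fits B (query_regs u v r)" for r
      using B(1) by (simp add: query_regs_def u_def v_def)
    show "M' (9 * p + j) = M j p" for p
      using j by (simp add: interleave_def)
  qed (rule fits_M[OF j])
  from query[OF i] obtain t regs2 where t: "t \<le> T" "regs2 0 = Word (w i)"
      "exec B c (query_regs u v, M j) t (regs2, M j)"
    unfolding u_def v_def j_def by blast
  from sim_exec[OF t(3) sim] obtain t' \<sigma> where \<sigma>: "t' \<le> 5 * t"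
      "exec B' (reloc c) (regs1, M') t' \<sigma>" "sim (regs2, M j) \<sigma>" "frame (regs1, M') \<sigma>"
    by blast
  \<comment> \<open>Cells of residue \<open>j\<close> agree with \<open>M j\<close> again because
    the query restores its image; the other cells are covered by \<open>frame\<close>.\<close>
  have "snd \<sigma> p = M' p" for p
  proof (cases "p mod 9 = j")
    case True
    then have "9 * (p div 9) + j = p" by auto
    then show ?thesis
      using \<sigma>(3) True unfolding sim_def interleave_def by (metis snd_conv)
  qed (use \<sigma>(4) in \<open>auto simp: frame_def\<close>)
  then have mem: "snd \<sigma> = M'" by auto
  have keep: "fst \<sigma> r = regs r" if "r \<notin> range (reg i)" "r \<noteq> 3" "r \<noteq> 4" "r \<noteq> 5" for r
    using \<sigma>(4) that by (auto simp: frame_def regs1_def)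
  have low: "r \<notin> range (reg i)" if "r < 10" for r
    using that reg_ge[of i] by (metis not_le rangeE)
  have "fst \<sigma> (reg i 0) = Word (w i)" and wB: "\<bar>w i\<bar> \<le> B"
    using \<sigma>(3) t(2) unfolding sim_def by (metis fst_conv fits.simps(1))+
  define sg where "sg = (if i mod 2 = i div 2 mod 2 then w i else - w i)"
  have acc: "acc (Suc i) = acc i + sg" by (simp add: acc_def sg_def)
  have accB: "\<bar>acc (Suc i)\<bar> \<le> int (Suc i) * B"
    using inv wB by (auto simp: acc invariant_def sg_def algebra_simps)
  have "int (Suc i) * B \<le> 36 * B"
    using i B by (intro mult_right_mono) auto
  with accB have "\<bar>acc i + sg\<bar> \<le> 36 * B"
    unfolding acc by (rule order_trans)
  also have "36 * B \<le> B'" using B(2) by simp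
  finally have fit: "\<bar>acc i + sg\<bar> \<le> B'" .
  define regs' where "regs' = (fst \<sigma>)(2 := Word (acc (Suc i)))"
  have "step B' (Alu (if i mod 2 = i div 2 mod 2 then Add else Sub) 2 2 (reg i 0)) \<sigma> = Some (regs', M')"
  proof -
    have "fst \<sigma> 2 = Word (acc i)"
      using keep[of 2] low[of 2] r01 by simp
    moreover have "alu (if i mod 2 = i div 2 mod 2 then Add else Sub) (acc i) (w i) = acc i + sg"
      by (simp add: sg_def)
    ultimately show ?thesis
      using fit mem \<open>fst \<sigma> (reg i 0) = Word (w i)\<close>
      by (simp only: step.simps cell.case prod.case set_reg_def fits.simps if_True regs'_def acc)
  qed
  note final = exec.Basic[OF this]
  have "exec B' (call c i) (regs, M') (6 + (t' + 1)) (regs', M')"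
    using exec.Seq[OF prep exec.Seq[OF \<sigma>(2) final]] unfolding call_def setup_code_def j_def .
  moreover have "invariant (Suc i) regs'"
    unfolding invariant_def
  proof (intro conjI allI impI)
    show "regs' 0 = Word a" "regs' 1 = Word b"
      using keep[of 0] keep[of 1] low[of 0] low[of 1] r01 by (auto simp: regs'_def)
    show "regs' (reg k r) = Word 0" if "k < 36" "Suc i \<le> k" for k r
    proof -
      have "reg k r \<notin> range (reg i)"
        using reg_eq[OF that(1) i] that(2) by auto
      then show ?thesis
        using keep[of "reg k r"] small[of k r] inv that by (auto simp: regs'_def invariant_def)
    qed
  qed (use accB in \<open>auto simp: regs'_def\<close>)
  moreover have "6 + (t' + 1) \<le> 5 * T + 7"
    using t(1) \<sigma>(1) by simp
  ultimately show ?thesis by blast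
qed

lemma exec_calls:
  "i \<le> 36 \<Longrightarrow> \<exists>t regs. t \<le> i * (5 * T + 7) \<and>
     exec B' (calls c i) (query_regs (Word a) (Word b), M') t (regs, M') \<and> invariant i regs"
proof (induction i)
  case 0
  have "invariant 0 (query_regs (Word a) (Word b))"
    using reg_ge by (auto simp: invariant_def query_regs_def acc_def reg_def)
  then show ?case
    by (intro exI[of _ 0] exI[of _ "query_regs (Word a) (Word b)"]) (simp add: exec.Skip)
next
  case (Suc i)
  then obtain t regs where 1: "t \<le> i * (5 * T + 7)"
      "exec B' (calls c i) (query_regs (Word a) (Word b), M') t (regs, M')" "invariant i regs"
    by auto
  obtain t' regs' where 2: "t' \<le> 5 * T + 7" "exec B' (call c i) (regs, M') t' (regs', M')"
      "invariant (Suc i) regs'"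
    using exec_call[OF _ 1(3)] Suc.prems by auto
  have "exec B' (calls c (Suc i)) (query_regs (Word a) (Word b), M') (t + t') (regs', M')"
    using exec.Seq[OF 1(2) 2(2)] by simp
  moreover have "t + t' \<le> Suc i * (5 * T + 7)"
    using 1(1) 2(1) by simp
  ultimately show ?case using 2(3) by blast
qed

lemma exec_disjointness_query:
  "\<exists>t regs. t \<le> 36 * (5 * T + 7) + 4 \<and> regs 0 = Word (if 0 < acc 36 then 0 else 1) \<and>
     exec B' (disjointness_query c) (query_regs (Word a) (Word b), M') t (regs, M')"
proof -
  obtain t regs where 1: "t \<le> 36 * (5 * T + 7)"
      "exec B' (calls c 36) (query_regs (Word a) (Word b), M') t (regs, M')" "invariant 36 regs"
    using exec_calls[of 36] by auto
  define regs1 where "regs1 = regs(3 := Word 0, 0 := Word 1)"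
  have "steps B' [Const 3 0, Const 0 1] (regs, M') = Some (regs1, M')"
    using B by (simp add: set_reg_def regs1_def)
  from exec_seq[OF this] have 2: "exec B' (seq [Const 3 0, Const 0 1]) (regs, M') 2 (regs1, M')"
    by (simp add: numeral_2_eq_2)
  have less: "less_cell (fst (regs1, M') 3) (fst (regs1, M') 2) = Some (0 < acc 36)"
    using 1(3) by (simp add: regs1_def invariant_def)
  have "\<exists>t'\<le>2. \<exists>regs'. regs' 0 = Word (if 0 < acc 36 then 0 else 1) \<and>
    exec B' (Branch 3 2 (Basic (Const 0 0)) Skip) (regs1, M') t' (regs', M')"
  proof (cases "0 < acc 36")
    case True
    have "exec B' (Basic (Const 0 0)) (regs1, M') 1 (regs1(0 := Word 0), M')"
      using B by (intro exec.Basic) (simp add: set_reg_def)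
    with less True have "exec B' (Branch 3 2 (Basic (Const 0 0)) Skip) (regs1, M') (1 + 1)
        (regs1(0 := Word 0), M')"
      by (intro exec.BranchTrue) auto
    with True show ?thesis
      by (intro exI[of _ "1 + 1"] exI[of _ "regs1(0 := Word 0)"] conjI) simp_all
  next
    case False
    with less have "exec B' (Branch 3 2 (Basic (Const 0 0)) Skip) (regs1, M') (0 + 1) (regs1, M')"
      by (intro exec.BranchFalse exec.Skip) auto
    with False show ?thesis
      by (intro exI[of _ "0 + 1"] exI[of _ regs1] conjI) (simp_all add: regs1_def)
  qed
  then obtain t' regs' where 3: "t' \<le> 2" "regs' 0 = Word (if 0 < acc 36 then 0 else 1)"
    "exec B' (Branch 3 2 (Basic (Const 0 0)) Skip) (regs1, M') t' (regs', M')"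
    by blast
  have "exec B' (disjointness_query c) (query_regs (Word a) (Word b), M') (t + (2 + t')) (regs', M')"
    unfolding disjointness_query_def by (intro exec.Seq[OF 1(2)] exec.Seq[OF 2] 3(3))
  moreover have "t + (2 + t') \<le> 36 * (5 * T + 7) + 4"
    using 1(1) 3(1) by simp
  ultimately show ?thesis using 3(2) by blast
qed

end

section \<open>The reduction\<close>

lemma soft_O_cmult: "f \<in> soft_O g \<Longrightarrow> (\<lambda>n. c * f n) \<in> soft_O g"
  unfolding soft_O_def by auto

text \<open>The constant is absorbed since \<open>g\<close> is at least 1 and \<open>ln n\<close> is
  at least 1 from \<open>n = 3\<close> on, as \<open>exp 1 \<le> 3\<close>.\<close>

lemma soft_O_add_const:
  assumes f: "f \<in> soft_O g" and g: "\<And>n. n \<ge> 1 \<Longrightarrow> 1 \<le> g n"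
  shows "(\<lambda>n. f n + c) \<in> soft_O g"
proof -
  obtain k :: nat where k: "f \<in> O(\<lambda>n. g n * ln (real n) ^ k)"
    using f by (auto simp: soft_O_def)
  have "(\<lambda>_. c) \<in> O(\<lambda>n. g n * ln (real n) ^ k)"
  proof (rule bigoI[where c = "\<bar>c\<bar>"], rule eventually_sequentiallyI[of 3])
    fix n :: nat assume n: "3 \<le> n"
    then have "exp 1 \<le> real n" using exp_le by linarith
    then have "1 \<le> ln (real n)"
      using n by (subst ln_ge_iff) auto
    then have "1 * 1 \<le> g n * ln (real n) ^ k"
      using g[of n] n by (intro mult_mono one_le_power) auto
    then show "norm c \<le> \<bar>c\<bar> * norm (g n * ln (real n) ^ k)"
      using mult_left_mono[of 1 "\<bar>g n * ln (real n) ^ k\<bar>" "\<bar>c\<bar>"] by simp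
  qed
  with k show ?thesis
    unfolding soft_O_def by (auto intro: sum_in_bigo)
qed

text \<open>For \<open>n = s + N\<close>, the word size \<open>5 * (n + 1) + N\<close> of the graphs
  plus 2 is at most \<open>(n + 2) ^ 3\<close>, which turns the exponent \<open>e\<close> into
  \<open>3 * e\<close>. The factor \<open>(n + 2) ^ 6\<close> absorbs the 36 and the added
  1.\<close>

lemma word_bound:
  fixes n N e :: nat
  assumes "2 \<le> n" "N \<le> n"
  shows "36 * ((int (5 * (n + 1) + N) + 2) ^ e + 1) \<le> (int n + 2) ^ (3 * e + 6)"
proof -
  have "int (5 * (n + 1) + N) + 2 \<le> 6 * int n + 7"
    using assms by simp
  also have "\<dots> \<le> (int n + 2) ^ 3"
    by (simp add: power3_eq_cube algebra_simps)
  finally have "(int (5 * (n + 1) + N) + 2) ^ e \<le> ((int n + 2) ^ 3) ^ e"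
    by (intro power_mono) auto
  then have le: "(int (5 * (n + 1) + N) + 2) ^ e \<le> (int n + 2) ^ (3 * e)"
    by (simp add: power_mult)
  have "(4 :: int) ^ 6 \<le> (int n + 2) ^ 6"
    using assms by (intro power_mono) auto
  then have "(int n + 2) ^ (3 * e) * 72 \<le> (int n + 2) ^ (3 * e) * (int n + 2) ^ 6"
    by (intro mult_left_mono) auto
  moreover have "1 \<le> (int n + 2) ^ (3 * e)"
    by (intro one_le_power) auto
  moreover have "36 * (x + 1) \<le> y * z" if "y * 72 \<le> y * z" "1 \<le> y" "x \<le> y" for x y z :: int
    using that unfolding distrib_left by linarith
  ultimately show ?thesis
    using le unfolding power_add by blast
qed

theorem theorem2:
  fixes lam :: "nat \<Rightarrow> real" and \<delta> :: real
  assumes "\<And>m. m \<ge> 1 \<Longrightarrow> 1 \<le> lam m \<and> lam m \<le> sqrt (real m)"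
    and "\<delta> > 0"
    and "has_structure (range_subgraph_counting wedge :: (nat graph \<times> (nat \<Rightarrow> real)) data_problem)
           (\<lambda>m. real m powr (2 - \<delta>) / (lam m)\<^sup>2) lam"
  shows "has_structure (set_disjointness :: (nat \<times> (nat \<Rightarrow> 'a set)) data_problem)
           (\<lambda>N. real N powr (2 - \<delta>) / (lam N)\<^sup>2) lam"
proof -
  let ?\<Pi> = "range_subgraph_counting wedge :: (nat graph \<times> (nat \<Rightarrow> real)) data_problem"
  let ?\<Delta> = "set_disjointness :: (nat \<times> (nat \<Rightarrow> 'a set)) data_problem"
  obtain c and e :: nat and S T :: "nat \<Rightarrow> nat" where
    S: "(\<lambda>n. real (S n)) \<in> soft_O (\<lambda>m. real m powr (2 - \<delta>) / (lam m)\<^sup>2)" and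
    T: "(\<lambda>n. real (T n)) \<in> soft_O lam" and
    c: "\<And>d. valid_data ?\<Pi> d \<Longrightarrow>
           \<exists>M. serves ((int (word_size ?\<Pi> d) + 2) ^ e) c M
                  (S (data_size ?\<Pi> d)) (T (data_size ?\<Pi> d)) (queries ?\<Pi> d)"
    using assms(3) unfolding has_structure_def by blast
  \<comment> \<open>Interleaving multiplies space by exactly 9. An additive constant would not be
    allowed: for \<open>\<delta> > 2\<close> the space bound tends to 0.\<close>
  have "(\<lambda>n. real (9 * S n)) \<in> soft_O (\<lambda>m. real m powr (2 - \<delta>) / (lam m)\<^sup>2)"
    using soft_O_cmult[OF S, of 9] by simp
  moreover have "(\<lambda>n. real (36 * (5 * T n + 7) + 4)) \<in> soft_O lam"
    using soft_O_add_const[OF soft_O_cmult[OF T, of 180], of 256] assms(1)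
    by (simp add: algebra_simps)
  moreover have "\<exists>M. serves ((int (word_size ?\<Delta> d) + 2) ^ (3 * e + 6)) (disjointness_query c) M
      (9 * S (data_size ?\<Delta> d)) (36 * (5 * T (data_size ?\<Delta> d) + 7) + 4) (queries ?\<Delta> d)"
    if valid: "valid_data ?\<Delta> d" for d
  proof -
    obtain s X where d: "d = (s, X)" by (cases d)
    define N where "N = (\<Sum>i=1..s. card (X i))"
    define n where "n = s + N"
    have s: "2 \<le> s" and fin: "\<And>i. i \<in> {1..s} \<Longrightarrow> finite (X i)"
      using valid by (auto simp: d set_disjointness_def)
    obtain G :: "nat \<Rightarrow> nat graph" where G: "\<And>j. is_graph (G j)" "\<And>j. card (snd (G j)) = N"
      "\<And>j. card (fst (G j)) = 5 * (n + 1)" and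
      G_meet: "\<And>a b. a \<in> {1..s} \<Longrightarrow> b \<in> {1..s} \<Longrightarrow> a \<noteq> b \<Longrightarrow>
        (\<Sum>j<9. wedge_count (G j) (- int a) (int b) - wedge_count (G j) (1 - int a) (int b)
          - wedge_count (G j) (- int a) (int b - 1) + wedge_count (G j) (1 - int a) (int b - 1)) > 0
        \<longleftrightarrow> X a \<inter> X b \<noteq> {}"
      using set_disjointness_graphs[of s X, OF fin, folded N_def, folded n_def] by blast
    define B where "B = (int (5 * (n + 1) + N) + 2) ^ e"
    define B' where "B' = (int n + 2) ^ (3 * e + 6)"
    have "1 \<le> B" unfolding B_def by (intro one_le_power) auto
    have BB': "36 * (B + 1) \<le> B'"
      unfolding B_def B'_def using s by (intro word_bound) (auto simp: n_def)
    have nB': "int n \<le> B'"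
      using self_le_power[of "int n + 2" "3 * e + 6"] by (simp add: B'_def)
    have "\<exists>M. serves B c M (S N) (T N) (queries ?\<Pi> (G j, position))" for j
      using c[of "(G j, position)"] G by (simp add: range_subgraph_counting_def B_def)
    then obtain M where M: "\<And>j. serves B c (M j) (S N) (T N) (queries ?\<Pi> (G j, position))"
      by metis
    have fits_M: "fits B (M j p)" for j p
      using M by (auto simp: serves_def)
    have zero_M: "M j p = Word 0" if "S N \<le> p" for j p
      using M that by (auto simp: serves_def)
    have run: "\<exists>t regs. t \<le> T N \<and> regs 0 = Word (wedge_count (G j) x y) \<and>
      exec B c (query_regs (Real (of_int x)) (Real (of_int y)), M j) t (regs, M j)"
      if "x \<le> y" for j x y
    proof -
      have "(Real (of_int x), Real (of_int y), Word (wedge_count (G j) x y))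
          \<in> queries ?\<Pi> (G j, position)"
        using that by (auto simp: range_subgraph_counting_def wedge_count_def)
      with M[of j] show ?thesis
        unfolding serves_def by fast
    qed
    have answer: "\<exists>t regs. t \<le> 36 * (5 * T N + 7) + 4 \<and>
        regs 0 = Word (if X a \<inter> X b = {} then 1 else 0) \<and>
        exec B' (disjointness_query c) (query_regs (Word (int a)) (Word (int b)), interleave 9 M) t
          (regs, interleave 9 M)"
      if ab: "a \<in> {1..s}" "b \<in> {1..s}" "a \<noteq> b" for a b
    proof -
      define w where "w i = wedge_count (G (i div 4)) (int (i mod 2) - int a)
        (int b - int (i div 2 mod 2))" for i
      interpret wedge_oracle c B B' "T N" M "int a" "int b" w
      proof
        show "int a \<le> B'" "int b \<le> B'" using ab nB' by (auto simp: n_def)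
        fix i :: nat assume "i < 36"
        \<comment> \<open>Queries require a nonempty interval: as \<open>a\<close> and
          \<open>b\<close> are at least 1, moving both endpoints still gives
          \<open>1 - a \<le> 0 \<le> b - 1\<close>.\<close>
        have "int (i mod 2) \<le> 1" "int (i div 2 mod 2) \<le> 1" by auto
        then have "int (i mod 2) - int a \<le> int b - int (i div 2 mod 2)"
          using ab(1,2) by (simp del: of_nat_mod)
        from run[OF this] show "\<exists>t regs. t \<le> T N \<and> regs 0 = Word (w i) \<and>
          exec B c (query_regs (Real (of_int (int (i mod 2) - int a)))
            (Real (of_int (int b - int (i div 2 mod 2)))), M (i div 4)) t (regs, M (i div 4))"
          unfolding w_def .
      qed (use \<open>1 \<le> B\<close> BB' fits_M ab in auto)
      \<comment> \<open>Each block of four consecutive calls forms the mixed difference for one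
        graph.\<close>
      have "acc 36 = (\<Sum>j<9. wedge_count (G j) (- int a) (int b) - wedge_count (G j) (1 - int a) (int b)
          - wedge_count (G j) (- int a) (int b - 1) + wedge_count (G j) (1 - int a) (int b - 1))"
        by (simp add: acc_def w_def lessThan_nat_numeral)
      then have "(if 0 < acc 36 then 0 else 1) = (if X a \<inter> X b = {} then 1 else 0 :: int)"
        using G_meet[OF ab] by simp
      with exec_disjointness_query show ?thesis by simp
    qed
    have "serves B' (disjointness_query c) (interleave 9 M) (9 * S N) (36 * (5 * T N + 7) + 4)
      (queries ?\<Delta> d)"
      unfolding serves_def
    proof (intro conjI allI impI ballI)
      have "B \<le> B'" using BB' \<open>1 \<le> B\<close> by simp
      then show "fits B' (interleave 9 M p)" for p
        unfolding interleave_def using fits_M fits_mono by blast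
      show "interleave 9 M p = Word 0" if "9 * S N \<le> p" for p
        unfolding interleave_def using that by (intro zero_M) auto
      fix q assume "q \<in> queries ?\<Delta> d"
      then obtain a b where ab: "a \<in> {1..s}" "b \<in> {1..s}" "a \<noteq> b" and
        q: "q = (Word (int a), Word (int b), Word (if X a \<inter> X b = {} then 1 else 0))"
        by (auto simp: set_disjointness_def d)
      show "case q of (u, v, r) \<Rightarrow> \<exists>t regs. t \<le> 36 * (5 * T N + 7) + 4 \<and> regs 0 = r \<and>
        exec B' (disjointness_query c) (query_regs u v, interleave 9 M) t (regs, interleave 9 M)"
        using answer[OF ab] unfolding q prod.case .
    qed
    then show ?thesis
      by (intro exI[of _ "interleave 9 M"])
        (simp add: d set_disjointness_def B'_def n_def N_def)
  qed
  ultimately show ?thesis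
    unfolding has_structure_def
    by (intro exI[of _ "disjointness_query c"] exI[of _ "3 * e + 6"] exI[of _ "\<lambda>n. 9 * S n"]
        exI[of _ "\<lambda>n. 36 * (5 * T n + 7) + 4"] conjI allI impI)
qed

end
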